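(* Let $d \ge 2$ and $0 \le k < d$ be integers. The following are equivalent: (i) $k \ge \frac{d}{2}$; (ii) there exists a compact set $K \subseteq [0,1]^d$ such that $K$ intersects each $k$-dimensional affine subspace of $\mathbb{R}^d$ that meets $[0,1]^d$, but $K+K$ is nowhere dense in $\mathbb{R}^d$.
   Context: $K+K=\{x+y : x,y\in K\}$ is the Minkowski sum. *)

theory Defs
  imports "HOL-Analysis.Analysis"
begin

definition nowhere_dense :: "'a::topological_space set \<Rightarrow> bool" where
  "nowhere_dense S \<longleftrightarrow> interior (closure S) = {}"

definition unit_cube :: "(real ^ 'n) set" where
  "unit_cube = {x. \<forall>i. 0 \<le> x $ i \<and> x $ i \<le> 1}"

end

theory Submission
  imports Defs
begin

text \<open>
  Let \<open>2 k < d\<close>, and let \<open>K\<close> meet all \<open>k\<close>-planes that meet the cube. Through a point of a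
  \<open>(d - k - 1)\<close>-face there is a \<open>k\<close>-plane meeting the cube in that point only, so \<open>K\<close> contains a
  \<open>k\<close>-face \<open>F\<close>. The planes parallel to \<open>F\<close> meet \<open>K\<close>, so finitely many translates of \<open>K + F\<close> cover
  a small cube, and \<open>K + F\<close> has interior.

  Let \<open>d \<le> 2 k\<close>. Then \<open>K\<close> is the intersection of a decreasing sequence of finite unions of boxes,
  each of which meets every \<open>k\<close>-plane met by its predecessor; every step removes one point \<open>p\<close> of a
  prescribed open set from the sumset, that is, the new union \<open>X'\<close> is disjoint from \<open>p - X'\<close>. Let \<open>L\<close>
  be the set of coordinates of corners and choose \<open>p\<close> with no coordinate in \<open>L + L\<close>. The new union
  consists of the points having more than \<open>k\<close> coordinates close to \<open>L\<close> (two such points share such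
  a coordinate, as \<open>2 k + 2 > d\<close>, so they do not add up to \<open>p\<close>), together with the part of a set
  \<open>{f \<ge> 1}\<close> away from the reflection of the former points. Here \<open>f\<close> is odd about \<open>p / 2\<close>, so \<open>{f \<ge> 1}\<close>
  is disjoint from its reflection, but it oscillates so much that every segment of a given length
  meets \<open>{f \<ge> 1}\<close>.
\<close>

section \<open>Segments in the intersection of a plane with a box\<close>

lemma dim_coordinate_subspace: "dim {v :: real^'n. \<forall>i. i \<notin> I \<longrightarrow> v $ i = 0} = card I"
  using dim_substandard_cart[where 'a=real and 'n='n, of I] by (simp add: dim_vec_eq)

text \<open>Dimension count: \<open>V\<close> and the space of vectors vanishing on \<open>C\<close>
  have dimensions adding up to more than that of the whole space, so they share a nonzero
  vector.\<close>

lemma subspace_vanishing_coordinates: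
  fixes V :: "(real^'n) set"
  assumes V: "subspace V" and C: "card C < dim V"
  obtains v where "v \<in> V" "v \<noteq> 0" "\<And>i. i \<in> C \<Longrightarrow> v $ i = 0"
proof -
  define W where "W = {v :: real^'n. \<forall>i. i \<notin> - C \<longrightarrow> v $ i = 0}"
  have W: "subspace W" unfolding W_def subspace_def by auto
  have dW: "dim W = card (- C)"
    unfolding W_def by (rule dim_coordinate_subspace)
  have cC: "card (- C) = CARD('n) - card C"
    by (simp add: card_Diff_subset Compl_eq_Diff_UNIV)
  have cle: "card C \<le> CARD('n)" by (simp add: card_mono)
  have "dim {x + y |x y. x \<in> V \<and> y \<in> W} \<le> CARD('n)"
    using dim_subset_UNIV_cart by blast
  moreover have "dim {x + y |x y. x \<in> V \<and> y \<in> W} + dim (V \<inter> W) = dim V + dim W"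
    by (rule dim_sums_Int[OF V W])
  ultimately have "dim (V \<inter> W) > 0" using C dW cC cle by linarith
  then have "\<not> V \<inter> W \<subseteq> {0}" by (metis dim_eq_0 less_irrefl)
  then obtain v where "v \<in> V" "v \<in> W" "v \<noteq> 0" by auto
  then show thesis using that unfolding W_def by auto
qed

text \<open>
  The witness is an extreme point of the sup-norm unit ball of the subspace of \<open>V\<close> supported in \<open>M\<close>:
  with too few active constraints it could be moved in both directions along a vector of \<open>V\<close>
  vanishing on the active coordinates.
\<close>

lemma subspace_sup_ball_vertex:
  fixes V :: "(real^'n) set"
  assumes V: "subspace V" and dim: "k \<le> dim V" and d: "CARD('n) \<le> 2 * k"
  obtains v where "v \<in> V" "\<And>i. i \<notin> M \<Longrightarrow> v $ i = 0" "\<And>i. \<bar>v $ i\<bar> \<le> 1"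
    "card M \<le> k + card {i. \<bar>v $ i\<bar> = 1}"
proof -
  define P where "P = {v \<in> V. (\<forall>i. i \<notin> M \<longrightarrow> v $ i = 0)} \<inter> cbox (- 1) 1"
  have sub: "subspace {v \<in> V. (\<forall>i. i \<notin> M \<longrightarrow> v $ i = 0)}"
    using V unfolding subspace_def by auto
  have Pmem: "v \<in> P \<longleftrightarrow> v \<in> V \<and> (\<forall>i. i \<notin> M \<longrightarrow> v $ i = 0) \<and> (\<forall>i. \<bar>v $ i\<bar> \<le> 1)" for v
    unfolding P_def by (auto simp: mem_box_cart abs_le_iff minus_le_iff)
  have "compact P" "convex P"
    unfolding P_def by (intro closed_Int_compact closed_subspace convex_Int subspace_imp_convex
        sub compact_cbox convex_box)+
  moreover have "0 \<in> P" using V by (simp add: Pmem subspace_0)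
  ultimately obtain v where v: "v extreme_point_of P"
    using extreme_point_exists_convex by blast
  then have vP: "v \<in> P" by (simp add: extreme_point_of_def)
  define Act where "Act = {i. \<bar>v $ i\<bar> = 1}"
  have "card M \<le> k + card Act"
  proof (rule ccontr)
    assume neg: "\<not> card M \<le> k + card Act"
    \<comment> \<open>Freezing the coordinates outside \<open>M\<close> and the active ones costs at
      most d - \<open>card M\<close> + \<open>card Act\<close> < d - k \<le> k constraints, so a
      nonzero direction \<open>w\<close> of \<open>V\<close> survives.\<close>
    have "card (- M \<union> Act) \<le> card (- M) + card Act" by (rule card_Un_le)
    moreover have "card (- M) = CARD('n) - card M" by (simp add: card_Diff_subset Compl_eq_Diff_UNIV)
    moreover have "card M \<le> CARD('n)" by (simp add: card_mono)
    ultimately have "card (- M \<union> Act) < dim V" using neg dim d by linarith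
    then obtain w where w: "w \<in> V" "w \<noteq> 0" "\<And>i. i \<in> - M \<union> Act \<Longrightarrow> w $ i = 0"
      using subspace_vanishing_coordinates[OF V] by blast
    have "\<exists>e>0. e * \<bar>w $ i\<bar> \<le> 1 - \<bar>v $ i\<bar>" for i
    proof (cases "i \<in> Act")
      case True
      then have "w $ i = 0" by (intro w(3) UnI2)
      moreover have "\<bar>v $ i\<bar> = 1" using True unfolding Act_def by (rule CollectD)
      ultimately have "0 < (1::real) \<and> 1 * \<bar>w $ i\<bar> \<le> 1 - \<bar>v $ i\<bar>" by simp
      then show ?thesis by (rule exI)
    next
      case False
      then have "\<bar>v $ i\<bar> \<noteq> 1" by (simp add: Act_def)
      moreover have "\<bar>v $ i\<bar> \<le> 1" using vP[unfolded Pmem] by (elim conjE) (erule spec)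
      ultimately have "\<bar>v $ i\<bar> < 1" by linarith
      moreover have "(1 - \<bar>v $ i\<bar>) / (1 + \<bar>w $ i\<bar>) * \<bar>w $ i\<bar> \<le> (1 - \<bar>v $ i\<bar>) * 1"
      proof -
        have "(1 - \<bar>v $ i\<bar>) * (\<bar>w $ i\<bar> / (1 + \<bar>w $ i\<bar>)) \<le> (1 - \<bar>v $ i\<bar>) * 1"
          using \<open>\<bar>v $ i\<bar> < 1\<close> by (intro mult_left_mono) (simp_all add: divide_le_eq add_pos_nonneg)
        then show ?thesis by simp
      qed
      moreover have "(1 - \<bar>v $ i\<bar>) / (1 + \<bar>w $ i\<bar>) > 0"
        using \<open>\<bar>v $ i\<bar> < 1\<close> by (intro divide_pos_pos) (simp_all add: add_pos_nonneg)
      ultimately show ?thesis by (metis mult.right_neutral)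
    qed
    then obtain e where e: "\<And>i. e i > 0" "\<And>i. e i * \<bar>w $ i\<bar> \<le> 1 - \<bar>v $ i\<bar>" by metis
    define \<epsilon> where "\<epsilon> = Min (range e)"
    have eps: "\<epsilon> > 0" using e by (simp add: \<epsilon>_def)
    have "\<epsilon> * \<bar>w $ i\<bar> \<le> 1 - \<bar>v $ i\<bar>" for i
    proof -
      have "\<epsilon> \<le> e i" by (simp add: \<epsilon>_def)
      then show ?thesis using e(2)[of i] by (meson abs_ge_zero mult_right_mono order_trans)
    qed
    then have b: "\<bar>v $ i\<bar> + \<bar>\<epsilon> * w $ i\<bar> \<le> 1" for i
      using eps by (simp add: abs_mult algebra_simps)
    have "v + \<epsilon> *\<^sub>R w \<in> P" "v - \<epsilon> *\<^sub>R w \<in> P"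
      unfolding Pmem using vP Pmem w V b
      by (auto simp: subspace_add subspace_diff subspace_mul intro: order_trans[OF abs_triangle_ineq] order_trans[OF abs_triangle_ineq4])
    moreover have "v \<in> open_segment (v - \<epsilon> *\<^sub>R w) (v + \<epsilon> *\<^sub>R w)"
    proof -
      have "v = midpoint (v - \<epsilon> *\<^sub>R w) (v + \<epsilon> *\<^sub>R w)"
        by (simp add: midpoint_def vec_eq_iff algebra_simps)
      moreover have "v - \<epsilon> *\<^sub>R w \<noteq> v + \<epsilon> *\<^sub>R w"
      proof
        assume "v - \<epsilon> *\<^sub>R w = v + \<epsilon> *\<^sub>R w"
        moreover have "(2 * \<epsilon>) *\<^sub>R w = (v + \<epsilon> *\<^sub>R w) - (v - \<epsilon> *\<^sub>R w)"
          by (simp add: vec_eq_iff)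
        ultimately have "(2 * \<epsilon>) *\<^sub>R w = 0" by simp
        then show False using eps w(2) by simp
      qed
      ultimately show ?thesis by (metis midpoint_in_open_segment)
    qed
    ultimately show False using v unfolding extreme_point_of_def by blast
  qed
  then show thesis using that vP Pmem unfolding Act_def by blast
qed

text \<open>
  If at most \<open>k\<close> coordinates of \<open>p - x\<close> are close to \<open>L\<close>, a short segment from \<open>x\<close> into the box will do.
  Otherwise those coordinates of \<open>x\<close> are themselves far from the faces of the box, and moving along
  the vertex of the previous lemma takes all but \<open>k\<close> of them away from \<open>L\<close>.
\<close>

lemma segment_off_reflected_corners:
  fixes x a b p :: "real^'n"
  assumes V: "subspace V" and dim: "k \<le> dim V" and d: "CARD('n) \<le> 2 * k"
    and u: "u > 0" and x: "x \<in> cbox a b" and ab: "\<And>i. a $ i < b $ i"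
    and end1: "\<And>i. a $ i \<in> L" and end2: "\<And>i. b $ i \<in> L"
    and sep: "\<And>l m. l \<in> L \<Longrightarrow> m \<in> L \<Longrightarrow> l \<noteq> m \<Longrightarrow> 10 * u \<le> \<bar>l - m\<bar>"
    and gen: "\<And>i l m. l \<in> L \<Longrightarrow> m \<in> L \<Longrightarrow> 10 * u \<le> \<bar>p $ i - l - m\<bar>"
    and far: "card {i. \<exists>l\<in>L. \<bar>x $ i - l\<bar> \<le> u / 2} \<le> k"
  obtains y v where "y - x \<in> V" "v \<in> V" "\<forall>i. \<bar>v $ i\<bar> \<le> 1" "\<exists>i. \<bar>v $ i\<bar> = 1"
    "\<forall>t. 0 \<le> t \<and> t \<le> u / 2 \<longrightarrow> y + t *\<^sub>R v \<in> cbox a b \<and>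
        card {i. \<exists>l\<in>L. \<bar>p $ i - (y + t *\<^sub>R v) $ i - l\<bar> < u} \<le> k"
proof -
  \<comment> \<open>\<open>M\<close> collects the coordinates in which the reflection of
    \<open>x\<close> is close to \<open>L\<close>, \<open>J\<close> those in which \<open>x\<close>
    itself is.\<close>
  define M where "M = {i. \<exists>l\<in>L. \<bar>p $ i - x $ i - l\<bar> \<le> 2 * u}"
  define J where "J = {i. \<exists>l\<in>L. \<bar>x $ i - l\<bar> \<le> u / 2}"
  have xab: "a $ i \<le> x $ i" "x $ i \<le> b $ i" for i using x by (auto simp: mem_box_cart)
  have gap: "10 * u \<le> b $ i - a $ i" for i
    using sep[OF end1 end2, of i i] ab[of i] by simp
  have cJ: "card J \<le> k" using far by (simp add: J_def)
  have kpos: "k > 0" using d zero_less_card_finite[where 'a='n] by linarith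
  show thesis
  proof (cases "card M \<le> k")
    case True
    \<comment> \<open>Here \<open>y\<close> is \<open>x\<close> itself. Only fewer than
      \<open>k\<close> coordinates can be frozen, so one coordinate \<open>j\<close> of
      \<open>J\<close> may stay free; the sign of the direction takes care of it.\<close>
    have "\<exists>j C. J \<subseteq> insert j C \<and> card C < k"
    proof (cases "J = {}")
      case True
      then show ?thesis using kpos by (intro exI[of _ undefined] exI[of _ "{}"]) simp
    next
      case False
      then obtain j where "j \<in> J" by auto
      then have "card (J - {j}) < card J" by (intro card_Diff1_less) auto
      then have "card (J - {j}) < k" using cJ by linarith
      then show ?thesis by (intro exI[of _ j] exI[of _ "J - {j}"]) auto
    qed
    then obtain j C where C: "J \<subseteq> insert j C" "card C < k" by (elim exE conjE) (rule that)
    then obtain v0 where v0: "v0 \<in> V" "v0 \<noteq> 0" "\<And>i. i \<in> C \<Longrightarrow> v0 $ i = 0"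
      using subspace_vanishing_coordinates[OF V less_le_trans[OF C(2) dim]] by metis
    define m where "m = Max (range (\<lambda>i. \<bar>v0 $ i\<bar>))"
    have m_ge: "\<bar>v0 $ i\<bar> \<le> m" for i unfolding m_def by simp
    have "m \<in> range (\<lambda>i. \<bar>v0 $ i\<bar>)" unfolding m_def by (rule Max_in) auto
    then obtain i0 where i0: "m = \<bar>v0 $ i0\<bar>" by auto
    obtain i1 where "v0 $ i1 \<noteq> 0" using v0(2) by (auto simp: vec_eq_iff)
    then have mpos: "m > 0" using m_ge[of i1] by linarith
    \<comment> \<open>The sign makes \<open>v $ j\<close> point inwards: nonnegative near the lower
      face, nonpositive otherwise.\<close>
    define s where "s = (if (v0 $ j \<ge> 0) = (\<bar>x $ j - a $ j\<bar> \<le> u / 2) then 1 else - 1 :: real)"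
    define v where "v = (s / m) *\<^sub>R v0"
    have s: "\<bar>s\<bar> = 1" unfolding s_def by auto
    have v1: "\<bar>v $ i\<bar> \<le> 1" for i
      using m_ge[of i] mpos s by (simp add: v_def abs_mult)
    have v2: "\<bar>v $ i0\<bar> = 1"
      using mpos s by (simp add: v_def abs_mult i0[symmetric])
    have vj: "(\<bar>x $ j - a $ j\<bar> \<le> u / 2 \<longrightarrow> 0 \<le> v $ j) \<and> (\<not> \<bar>x $ j - a $ j\<bar> \<le> u / 2 \<longrightarrow> v $ j \<le> 0)"
      using mpos by (auto simp: v_def s_def zero_le_divide_iff divide_le_0_iff zero_le_mult_iff mult_le_0_iff)
    have "x + t *\<^sub>R v \<in> cbox a b \<and> card {i. \<exists>l\<in>L. \<bar>p $ i - (x + t *\<^sub>R v) $ i - l\<bar> < u} \<le> k"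
      if t: "0 \<le> t" "t \<le> u / 2" for t
    proof
      have tv: "\<bar>t * v $ i\<bar> \<le> u / 2" for i
        using mult_mono[OF t(2) v1[of i]] t u by (simp add: abs_mult)
      have "a $ i \<le> x $ i + t * v $ i \<and> x $ i + t * v $ i \<le> b $ i" for i
      proof -
        consider "i \<notin> J" | "i \<in> C" | "i = j" using C by auto
        then show ?thesis
        proof cases
          case 1
          then have "\<not> \<bar>x $ i - a $ i\<bar> \<le> u / 2" "\<not> \<bar>x $ i - b $ i\<bar> \<le> u / 2"
            using end1 end2 unfolding J_def by auto
          then show ?thesis using tv[of i] xab[of i] by (intro conjI; linarith)
        next
          case 2
          then show ?thesis using v0(3) xab by (simp add: v_def)
        next
          case 3
          show ?thesis
          proof (cases "\<bar>x $ j - a $ j\<bar> \<le> u / 2")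
            case True
            then have "0 \<le> t * v $ j" using vj t by simp
            then show ?thesis using True tv[of j] xab[of j] gap[of j] u unfolding 3 by (intro conjI; linarith)
          next
            case False
            then have "t * v $ j \<le> 0" using vj t by (simp add: mult_nonneg_nonpos)
            then show ?thesis using False tv[of j] xab[of j] gap[of j] u unfolding 3 by (intro conjI; linarith)
          qed
        qed
      qed
      then show "x + t *\<^sub>R v \<in> cbox a b" by (simp add: mem_box_cart)
      have "{i. \<exists>l\<in>L. \<bar>p $ i - (x + t *\<^sub>R v) $ i - l\<bar> < u} \<subseteq> M"
      proof clarify
        fix i l assume "l \<in> L" "\<bar>p $ i - (x + t *\<^sub>R v) $ i - l\<bar> < u"
        then have "\<bar>p $ i - x $ i - l\<bar> \<le> 2 * u" using tv[of i] u by simp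
        then show "i \<in> M" unfolding M_def using \<open>l \<in> L\<close> by blast
      qed
      then show "card {i. \<exists>l\<in>L. \<bar>p $ i - (x + t *\<^sub>R v) $ i - l\<bar> < u} \<le> k"
        using True by (meson card_mono finite order_trans)
    qed
    moreover have "v \<in> V" using V v0 by (simp add: v_def subspace_mul)
    moreover have "x - x \<in> V" using V by (simp add: subspace_0)
    ultimately show thesis using v1 v2 by (intro that[of x v] exI[of _ i0] allI impI) auto
  next
    case False
    obtain v where v: "v \<in> V" "\<And>i. i \<notin> M \<Longrightarrow> v $ i = 0" "\<And>i. \<bar>v $ i\<bar> \<le> 1"
      "card M \<le> k + card {i. \<bar>v $ i\<bar> = 1}"
      using subspace_sup_ball_vertex[OF V dim d] by blast
    have "{i. \<bar>v $ i\<bar> = 1} \<noteq> {}" using v(4) False by (metis add_0_right card.empty)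
    have ActM: "{i. \<bar>v $ i\<bar> = 1} \<subseteq> M" using v(2) by force
    have "(x + (3 * u) *\<^sub>R v) + t *\<^sub>R v \<in> cbox a b \<and>
        card {i. \<exists>l\<in>L. \<bar>p $ i - ((x + (3 * u) *\<^sub>R v) + t *\<^sub>R v) $ i - l\<bar> < u} \<le> k"
      if t: "0 \<le> t" "t \<le> u / 2" for t
    proof -
      define r where "r = 3 * u + t"
      have r: "3 * u \<le> r" "r \<le> 4 * u" using t u by (auto simp: r_def)
      have eq: "(x + (3 * u) *\<^sub>R v) + t *\<^sub>R v = x + r *\<^sub>R v"
        by (simp add: r_def scaleR_add_left)
      have rv: "\<bar>r * v $ i\<bar> \<le> 4 * u" for i
        using mult_mono[OF r(2) v(3)[of i]] r u by (simp add: abs_mult)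
      \<comment> \<open>For \<open>i\<close> in \<open>M\<close>, \<open>gen\<close> puts
        \<open>x $ i\<close> at least \<open>8 * u\<close> from both faces, more than the
        displacement \<open>4 * u\<close>; the other coordinates do not move.\<close>
      have "a $ i \<le> x $ i + r * v $ i \<and> x $ i + r * v $ i \<le> b $ i" for i
      proof (cases "i \<in> M")
        case True
        then obtain l where l: "l \<in> L" "\<bar>p $ i - x $ i - l\<bar> \<le> 2 * u" unfolding M_def by auto
        then show ?thesis
          using gen[OF l(1) end1, of i i] gen[OF l(1) end2, of i i] rv[of i] xab[of i] u
          by (intro conjI; linarith)
      qed (use v(2) xab in simp)
      then have 1: "x + r *\<^sub>R v \<in> cbox a b" by (simp add: mem_box_cart)
      have "{i. \<exists>l\<in>L. \<bar>p $ i - (x + r *\<^sub>R v) $ i - l\<bar> < u} \<subseteq> M - {i. \<bar>v $ i\<bar> = 1}"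
      proof (intro subsetI)
        fix i assume "i \<in> {i. \<exists>l\<in>L. \<bar>p $ i - (x + r *\<^sub>R v) $ i - l\<bar> < u}"
        then obtain l where l: "l \<in> L" and li: "\<bar>p $ i - x $ i - r * v $ i - l\<bar> < u"
          by (auto simp: algebra_simps)
        have iM: "i \<in> M"
        proof (rule ccontr)
          assume "i \<notin> M"
          then show False using v(2)[of i] li l u unfolding M_def by force
        qed
        then obtain m where m: "m \<in> L" "\<bar>p $ i - x $ i - m\<bar> \<le> 2 * u" unfolding M_def by auto
        \<comment> \<open>A coordinate of full speed moves by between \<open>3 * u\<close> and
          \<open>4 * u\<close>: far enough to leave \<open>m\<close> behind by \<open>u\<close>, too
          little to come near another point of \<open>L\<close>, as these are \<open>10 * u\<close>
          apart.\<close>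
        have "\<bar>v $ i\<bar> \<noteq> 1"
        proof
          assume "\<bar>v $ i\<bar> = 1"
          then have "\<bar>r * v $ i\<bar> = r" using r u by (simp add: abs_mult)
          then show False using m(2) li r u sep[OF l m(1)] by (cases "l = m") linarith+
        qed
        then show "i \<in> M - {i. \<bar>v $ i\<bar> = 1}" using iM by simp
      qed
      then have "card {i. \<exists>l\<in>L. \<bar>p $ i - (x + r *\<^sub>R v) $ i - l\<bar> < u} \<le> card (M - {i. \<bar>v $ i\<bar> = 1})"
        by (simp add: card_mono)
      also have "\<dots> = card M - card {i. \<bar>v $ i\<bar> = 1}"
        using ActM by (simp add: card_Diff_subset)
      also have "\<dots> \<le> k" using v(4) by simp
      finally show ?thesis unfolding eq using 1 by blast
    qed
    moreover have "x + (3 * u) *\<^sub>R v - x \<in> V" using V v(1) by (simp add: subspace_mul)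
    moreover have "\<exists>i. \<bar>v $ i\<bar> = 1" using \<open>{i. \<bar>v $ i\<bar> = 1} \<noteq> {}\<close> by simp
    ultimately show thesis using v(1,3) by (intro that[of "x + (3 * u) *\<^sub>R v" v] allI impI) auto
  qed
qed

section \<open>An odd function that is large on all long segments\<close>

text \<open>Sine is at least 1/2 on phases from pi/6 to 5 pi/6, and the interval of length
  \<open>h\<close> covers two periods, so it contains such a stretch entirely. Its length is
  computed from the largest speed \<open>\<alpha>1\<close> and thus is uniform in
  \<open>\<alpha>\<close>.\<close>

lemma sin_ge_half_subinterval:
  fixes \<alpha> \<beta> a h :: real
  assumes \<alpha>: "\<alpha>0 \<le> \<bar>\<alpha>\<bar>" "\<bar>\<alpha>\<bar> \<le> \<alpha>1" and pos: "\<alpha>0 > 0" and h: "4 * pi \<le> \<alpha>0 * h"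
  obtains a' where "a \<le> a'" "a' + 2 * pi / (3 * \<alpha>1) \<le> a + h"
    "\<And>t. a' \<le> t \<Longrightarrow> t \<le> a' + 2 * pi / (3 * \<alpha>1) \<Longrightarrow> 1 / 2 \<le> sin (\<alpha> * t + \<beta>)"
proof -
  have main: "\<exists>a'\<ge>a. a' + 2 * pi / (3 * \<alpha>1) \<le> a + h \<and>
      (\<forall>t. a' \<le> t \<longrightarrow> t \<le> a' + 2 * pi / (3 * \<alpha>1) \<longrightarrow> 1 / 2 \<le> sin (\<alpha> * t + \<beta>))"
    if "\<alpha>0 \<le> \<alpha>" "\<alpha> \<le> \<alpha>1" for \<alpha> \<beta> :: real
  proof -
    have ap: "\<alpha> > 0" "\<alpha>1 > 0" using pos that by auto
    \<comment> \<open>\<open>a'\<close> is the first point from \<open>a\<close> on where the phase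
      is pi/6 modulo 2 pi.\<close>
    define m where "m = \<lceil>(\<alpha> * a + \<beta> - pi / 6) / (2 * pi)\<rceil>"
    define a' where "a' = (pi / 6 + 2 * pi * m - \<beta>) / \<alpha>"
    have "(\<alpha> * a + \<beta> - pi / 6) / (2 * pi) \<le> m" "m < (\<alpha> * a + \<beta> - pi / 6) / (2 * pi) + 1"
      unfolding m_def by linarith+
    then have m: "\<alpha> * a + \<beta> - pi / 6 \<le> 2 * pi * m" "2 * pi * m < \<alpha> * a + \<beta> - pi / 6 + 2 * pi"
      by (simp_all add: field_simps)
    have aa: "\<alpha> * a' = pi / 6 + 2 * pi * m - \<beta>" using ap by (simp add: a'_def)
    have 1: "a \<le> a'"
    proof -
      have "\<alpha> * a \<le> \<alpha> * a'" using m aa by linarith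
      then show ?thesis using ap by simp
    qed
    have le: "\<alpha> * (2 * pi / (3 * \<alpha>1)) \<le> 2 * pi / 3"
      using ap that by (simp add: field_simps)
    have "4 * pi \<le> \<alpha> * h"
    proof -
      have "h > 0" using h pos pi_gt_zero by (smt (verit) mult_nonneg_nonpos)
      then show ?thesis using h that by (meson mult_right_mono less_imp_le order_trans)
    qed
    then have "\<alpha> * (a' + 2 * pi / (3 * \<alpha>1)) \<le> \<alpha> * (a + h)"
      using m aa le pi_gt_zero unfolding distrib_left by linarith
    then have 2: "a' + 2 * pi / (3 * \<alpha>1) \<le> a + h" using ap by simp
    have "1 / 2 \<le> sin (\<alpha> * t + \<beta>)" if t: "a' \<le> t" "t \<le> a' + 2 * pi / (3 * \<alpha>1)" for t
    proof -
      define w where "w = \<alpha> * t + \<beta> - 2 * pi * m - pi / 2"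
      have "\<alpha> * a' \<le> \<alpha> * t" "\<alpha> * t \<le> \<alpha> * (a' + 2 * pi / (3 * \<alpha>1))"
        using t ap by (auto intro: mult_left_mono)
      then have "\<bar>w\<bar> \<le> pi / 3" using aa le unfolding w_def distrib_left by linarith
      then have "cos (pi / 3) \<le> cos \<bar>w\<bar>" by (intro cos_monotone_0_pi_le) auto
      then have "1 / 2 \<le> cos w" by (simp add: cos_60)
      also have "cos w = sin (w + pi / 2)" by (simp add: sin_add)
      also have "w + pi / 2 = \<alpha> * t + \<beta> + 2 * pi * of_int (- m)" by (simp add: w_def)
      also have "sin \<dots> = sin (\<alpha> * t + \<beta>)"
        unfolding sin_add by (simp add: sin_int_2pin cos_int_2pin)
      finally show ?thesis .
    qed
    then show ?thesis using 1 2 by blast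
  qed
  show thesis
  proof (cases "\<alpha> > 0")
    case True
    then show thesis using main[of \<alpha> \<beta>] \<alpha> that by auto
  next
    case False
    \<comment> \<open>Negative speeds reduce to positive ones by sin (pi - z) = sin z.\<close>
    have "sin (- \<alpha> * t + (pi - \<beta>)) = sin (\<alpha> * t + \<beta>)" for t
      using sin_pi_minus[of "\<alpha> * t + \<beta>"] by (simp add: algebra_simps)
    then show thesis using main[of "- \<alpha>" "pi - \<beta>"] \<alpha> that False by auto
  qed
qed

text \<open>Induction by nested intervals: each new frequency is so high that the interval found for
  the previous sines contains a good stretch for the new one. The order of quantifiers matters:
  \<open>M\<close> and \<open>l\<close> are fixed before the speeds, phases, index set and starting
  point.\<close>

lemma lacunary_sines_simultaneously_large:
  fixes \<kappa> h S :: real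
  assumes "\<kappa> > 0" "h > 0"
  shows "\<exists>(M :: nat \<Rightarrow> real) l. l > 0 \<and> (\<forall>(s :: nat \<Rightarrow> real) \<phi> G a. G \<subseteq> {..<n} \<longrightarrow>
    (\<forall>j\<in>G. \<kappa> \<le> \<bar>s j\<bar> \<and> \<bar>s j\<bar> \<le> S) \<longrightarrow>
    (\<exists>a'\<ge>a. a' + l \<le> a + h \<and>
      (\<forall>t j. a' \<le> t \<longrightarrow> t \<le> a' + l \<longrightarrow> j \<in> G \<longrightarrow> 1 / 2 \<le> sin (M j * (s j * t + \<phi> j)))))"
proof (induction n)
  case 0
  show ?case using assms by (intro exI[of _ "\<lambda>_. 0"] exI[of _ h]) auto
next
  case (Suc n)
  then obtain M l where l: "l > 0" and IH: "\<And>(s :: nat \<Rightarrow> real) \<phi> G a. G \<subseteq> {..<n} \<Longrightarrow>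
    (\<forall>j\<in>G. \<kappa> \<le> \<bar>s j\<bar> \<and> \<bar>s j\<bar> \<le> S) \<Longrightarrow>
    (\<exists>a'\<ge>a. a' + l \<le> a + h \<and>
      (\<forall>t j. a' \<le> t \<longrightarrow> t \<le> a' + l \<longrightarrow> j \<in> G \<longrightarrow> 1 / 2 \<le> sin (M j * (s j * t + \<phi> j))))"
    by blast
  \<comment> \<open>The maximum with \<open>\<kappa>\<close> keeps the divisor positive for every
    \<open>S\<close>.\<close>
  define B where "B = max S \<kappa>"
  have B: "B > 0" using assms by (simp add: B_def)
  \<comment> \<open>Even at the slowest speed \<open>\<kappa>\<close> the new sine runs through two
    periods on an interval of length \<open>l\<close>.\<close>
  define \<mu> where "\<mu> = 4 * pi / (\<kappa> * l)"
  have \<mu>: "\<mu> > 0" using assms l by (simp add: \<mu>_def)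
  define l' where "l' = min l (2 * pi / (3 * (\<mu> * B)))"
  have l': "l' > 0" "l' \<le> l" "l' \<le> 2 * pi / (3 * (\<mu> * B))" using l \<mu> B by (auto simp: l'_def)
  define M' where "M' = M(n := \<mu>)"
  have "\<exists>a'\<ge>a. a' + l' \<le> a + h \<and>
      (\<forall>t j. a' \<le> t \<longrightarrow> t \<le> a' + l' \<longrightarrow> j \<in> G \<longrightarrow> 1 / 2 \<le> sin (M' j * (s j * t + \<phi> j)))"
    if G: "G \<subseteq> {..<Suc n}" and s: "\<forall>j\<in>G. \<kappa> \<le> \<bar>s j\<bar> \<and> \<bar>s j\<bar> \<le> S"
    for s \<phi> :: "nat \<Rightarrow> real" and G and a :: real
  proof -
    have "G - {n} \<subseteq> {..<n}" using G by auto
    then obtain a1 where a1: "a \<le> a1" "a1 + l \<le> a + h" and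
      old: "\<And>t j. a1 \<le> t \<Longrightarrow> t \<le> a1 + l \<Longrightarrow> j \<in> G - {n} \<Longrightarrow> 1 / 2 \<le> sin (M j * (s j * t + \<phi> j))"
      using IH[of "G - {n}" s a \<phi>] s by auto
    show ?thesis
    proof (cases "n \<in> G")
      case False
      then show ?thesis using a1 l' old
        by (intro exI[of _ a1]) (auto simp: M'_def)
    next
      case True
      have "\<mu> * \<kappa> \<le> \<bar>\<mu> * s n\<bar>" "\<bar>\<mu> * s n\<bar> \<le> \<mu> * B" "\<mu> * \<kappa> > 0" "4 * pi \<le> \<mu> * \<kappa> * l"
        using s True \<mu> assms l by (auto simp: abs_mult B_def) (auto simp: \<mu>_def)
      then obtain a2 where a2: "a1 \<le> a2" "a2 + 2 * pi / (3 * (\<mu> * B)) \<le> a1 + l" and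
        new: "\<And>t. a2 \<le> t \<Longrightarrow> t \<le> a2 + 2 * pi / (3 * (\<mu> * B)) \<Longrightarrow> 1 / 2 \<le> sin ((\<mu> * s n) * t + \<mu> * \<phi> n)"
        using sin_ge_half_subinterval[of "\<mu> * \<kappa>" "\<mu> * s n" "\<mu> * B" l a1 "\<mu> * \<phi> n"] by metis
      have "1 / 2 \<le> sin (M' j * (s j * t + \<phi> j))"
        if "a2 \<le> t" "t \<le> a2 + l'" "j \<in> G" for t j
      proof (cases "j = n")
        case True
        then show ?thesis using new[of t] that l' by (simp add: M'_def algebra_simps)
      next
        case False
        then show ?thesis using old[of t j] that l' a1 a2 by (simp add: M'_def)
      qed
      then show ?thesis using a1 a2 l' by (intro exI[of _ a2]) auto
    qed
  qed
  then show ?case using l' by (intro exI[of _ M'] exI[of _ l']) blast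
qed

text \<open>Points of the moment curve: \<open>w j \<bullet> v\<close> is the value at
  \<open>j\<close> of a polynomial with coefficients \<open>v\<close>, which has degree below the
  dimension d and so fewer than d roots.\<close>

lemma moment_curve_general_position:
  obtains w :: "nat \<Rightarrow> real^'n" where
    "\<And>v D. v \<noteq> 0 \<Longrightarrow> card D = CARD('n) \<Longrightarrow> \<exists>j\<in>D. w j \<bullet> v \<noteq> 0"
proof -
  obtain e :: "'n \<Rightarrow> nat" where e: "bij_betw e UNIV {0..<CARD('n)}"
    using ex_bij_betw_finite_nat[of "UNIV :: 'n set"] by auto
  then have inj: "inj e" by (simp add: bij_betw_def)
  define w :: "nat \<Rightarrow> real^'n" where "w j = (\<chi> i. real j ^ e i)" for j
  have "\<exists>j\<in>D. w j \<bullet> v \<noteq> 0" if v: "v \<noteq> 0" and D: "card D = CARD('n)" for v D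
  proof (rule ccontr)
    assume neg: "\<not> (\<exists>j\<in>D. w j \<bullet> v \<noteq> 0)"
    define q where "q = (\<Sum>i\<in>UNIV. monom (v $ i) (e i))"
    have "coeff q (e i) = v $ i" for i
      unfolding q_def coeff_sum using inj
      by (simp add: inj_eq)
    then have q0: "q \<noteq> 0" using v by (metis coeff_0 vec_eq_iff zero_index)
    have "degree q \<le> CARD('n) - 1"
      unfolding q_def
    proof (rule degree_sum_le)
      fix i :: 'n
      have "e i < CARD('n)" using e by (auto simp: bij_betw_def)
      then show "degree (monom (v $ i) (e i)) \<le> CARD('n) - 1"
        using degree_monom_le[of "v $ i" "e i"] by linarith
    qed auto
    then have deg: "degree q < CARD('n)"
      using zero_less_card_finite[where 'a='n] by linarith
    have "poly q (real j) = w j \<bullet> v" for j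
      by (simp add: q_def w_def poly_sum poly_monom inner_vec_def mult.commute)
    then have "real ` D \<subseteq> {z. poly q z = 0}" using neg by auto
    then have "card (real ` D) \<le> degree q"
      using card_mono[OF poly_roots_finite[OF q0]] card_poly_roots_bound[OF q0] by (meson order_trans)
    moreover have "card (real ` D) = card D" by (simp add: card_image)
    ultimately show False using D deg by simp
  qed
  then show thesis using that by blast
qed

text \<open>
  A sum of sines in \<open>3 d\<close> directions in general position, with frequencies growing so fast that on any
  segment all terms but those (fewer than \<open>d\<close>) with direction almost orthogonal to the segment can be made
  at least \<open>1 / 2\<close> simultaneously.
\<close>

lemma odd_function_large_on_segments:
  fixes c :: "real^'n" and h :: real
  assumes h: "h > 0"
  obtains f :: "real^'n \<Rightarrow> real" where "continuous_on UNIV f"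
    "\<forall>y. f (2 *\<^sub>R c - y) = - f y"
    "\<forall>x v. (\<forall>i. \<bar>v $ i\<bar> \<le> 1) \<longrightarrow> (\<exists>i. \<bar>v $ i\<bar> = 1) \<longrightarrow> (\<exists>t. 0 \<le> t \<and> t \<le> h \<and> 1 \<le> f (x + t *\<^sub>R v))"
proof -
  let ?d = "CARD('n)"
  \<comment> \<open>Fewer than d terms will be uncontrolled, each at least -1; the more than 2 d
    others contribute at least 1/2 each, which leaves a total of at least 1.\<close>
  define N where "N = 3 * ?d"
  obtain w :: "nat \<Rightarrow> real^'n" where
    w: "\<And>v D. v \<noteq> 0 \<Longrightarrow> card D = ?d \<Longrightarrow> \<exists>j\<in>D. w j \<bullet> v \<noteq> 0"
    using moment_curve_general_position by metis
  \<comment> \<open>The sup-norm unit sphere; its compactness gives lower bounds uniform in the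
    direction.\<close>
  define T where "T = {v :: real^'n. (\<forall>i. \<bar>v $ i\<bar> \<le> 1) \<and> (\<exists>i. \<bar>v $ i\<bar> = 1)}"
  have T_eq: "T = cbox (- 1) 1 \<inter> (\<Union>i. {v. \<bar>v $ i\<bar> = 1})"
    by (auto simp: T_def mem_box_cart abs_le_iff minus_le_iff)
  have "closed (\<Union>i. {v :: real^'n. \<bar>v $ i\<bar> = 1})"
    by (intro closed_UN ballI closed_Collect_eq continuous_intros) auto
  then have T: "compact T" unfolding T_eq by (intro compact_Int_closed) auto
  have T0: "v \<noteq> 0" if "v \<in> T" for v using that by (auto simp: T_def)
  have "\<exists>\<kappa>>0. \<forall>v\<in>T. \<kappa> \<le> (\<Sum>j\<in>D. \<bar>w j \<bullet> v\<bar>)" if D: "card D = ?d" for D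
  proof (cases "T = {}")
    case False
    have fD: "finite D" using D by (intro card_ge_0_finite) (simp add: zero_less_card_finite)
    have "continuous_on T (\<lambda>v. \<Sum>j\<in>D. \<bar>w j \<bullet> v\<bar>)" by (intro continuous_intros)
    then obtain v0 where v0: "v0 \<in> T" "\<forall>v\<in>T. (\<Sum>j\<in>D. \<bar>w j \<bullet> v0\<bar>) \<le> (\<Sum>j\<in>D. \<bar>w j \<bullet> v\<bar>)"
      using continuous_attains_inf[OF T False] by blast
    obtain j where "j \<in> D" "w j \<bullet> v0 \<noteq> 0" using w[OF T0[OF v0(1)] D] by blast
    then have "(\<Sum>j\<in>D. \<bar>w j \<bullet> v0\<bar>) > 0" using fD by (intro sum_pos2[of _ j]) auto
    then show ?thesis using v0 by blast
  qed (auto intro: exI[of _ 1])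
  then obtain K where K: "\<And>D. card D = ?d \<Longrightarrow> K D > 0"
    "\<And>D v. card D = ?d \<Longrightarrow> v \<in> T \<Longrightarrow> K D \<le> (\<Sum>j\<in>D. \<bar>w j \<bullet> v\<bar>)" by metis
  define \<D> where "\<D> = {D. D \<subseteq> {..<N} \<and> card D = ?d}"
  have \<D>: "finite \<D>" unfolding \<D>_def by simp
  \<comment> \<open>If d of the inner products were all below \<open>\<kappa>\<close>, their
    absolute sum would be below the bound \<open>K D\<close>. Inserting 1 keeps the set
    nonempty.\<close>
  define \<kappa> where "\<kappa> = Min (insert 1 (K ` \<D>)) / ?d"
  have \<kappa>: "\<kappa> > 0" using \<D> K(1) by (simp add: \<kappa>_def \<D>_def)
  have bad: "card {j \<in> {..<N}. \<bar>w j \<bullet> v\<bar> < \<kappa>} < ?d" if v: "v \<in> T" for v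
  proof (rule ccontr)
    assume "\<not> ?thesis"
    then have "?d \<le> card {j \<in> {..<N}. \<bar>w j \<bullet> v\<bar> < \<kappa>}" by linarith
    then obtain D where D: "D \<subseteq> {j \<in> {..<N}. \<bar>w j \<bullet> v\<bar> < \<kappa>}" "card D = ?d" "finite D"
      by (rule obtain_subset_with_card_n)
    have "D \<noteq> {}" using D(2) by auto
    have "D \<in> \<D>" using D unfolding \<D>_def by auto
    then have "?d * \<kappa> \<le> K D" using \<D> by (simp add: \<kappa>_def)
    also have "\<dots> \<le> (\<Sum>j\<in>D. \<bar>w j \<bullet> v\<bar>)" using K(2) D v by blast
    also have "\<dots> < (\<Sum>j\<in>D. \<kappa>)"
      using D \<open>D \<noteq> {}\<close> by (intro sum_strict_mono) auto
    finally show False using D by simp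
  qed
  define S where "S = (\<Sum>j<N. norm (w j)) * ?d"
  have S: "\<bar>w j \<bullet> v\<bar> \<le> S" if "v \<in> T" "j < N" for j v
  proof -
    have "norm v \<le> (\<Sum>i\<in>UNIV. \<bar>v $ i\<bar>)" by (rule norm_le_l1_cart)
    also have "\<dots> \<le> real ?d * 1" using that by (intro sum_bounded_above) (auto simp: T_def)
    finally have "norm v \<le> ?d" by simp
    moreover have "norm (w j) \<le> (\<Sum>j<N. norm (w j))"
      using that by (intro member_le_sum) auto
    ultimately have "norm (w j) * norm v \<le> S" unfolding S_def
      by (intro mult_mono) (auto intro: sum_nonneg)
    then show ?thesis using Cauchy_Schwarz_ineq2 order_trans by blast
  qed
  obtain M l where l: "l > 0" and M: "\<And>(s :: nat \<Rightarrow> real) \<phi> G a. G \<subseteq> {..<N} \<Longrightarrow>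
    (\<forall>j\<in>G. \<kappa> \<le> \<bar>s j\<bar> \<and> \<bar>s j\<bar> \<le> S) \<Longrightarrow>
    (\<exists>a'\<ge>a. a' + l \<le> a + h \<and>
      (\<forall>t j. a' \<le> t \<longrightarrow> t \<le> a' + l \<longrightarrow> j \<in> G \<longrightarrow> 1 / 2 \<le> sin (M j * (s j * t + \<phi> j))))"
    using lacunary_sines_simultaneously_large[OF \<kappa> h, where n=N and S=S] by blast
  define f where "f y = (\<Sum>j<N. sin (M j * (w j \<bullet> (y - c))))" for y
  have "continuous_on UNIV f" unfolding f_def by (intro continuous_intros)
  moreover have "f (2 *\<^sub>R c - y) = - f y" for y
  proof -
    have "2 *\<^sub>R c - y - c = - (y - c)" by (simp add: scaleR_2)
    then show ?thesis unfolding f_def by (simp only: inner_minus_right mult_minus_right sin_minus sum_negf)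
  qed
  moreover have "\<exists>t. 0 \<le> t \<and> t \<le> h \<and> 1 \<le> f (x + t *\<^sub>R v)"
    if "\<And>i. \<bar>v $ i\<bar> \<le> 1" "\<exists>i. \<bar>v $ i\<bar> = 1" for x v
  proof -
    have v: "v \<in> T" using that by (simp add: T_def)
    define Bd where "Bd = {j \<in> {..<N}. \<bar>w j \<bullet> v\<bar> < \<kappa>}"
    define G where "G = {j \<in> {..<N}. \<kappa> \<le> \<bar>w j \<bullet> v\<bar>}"
    have fin: "finite G" "finite Bd" by (auto simp: G_def Bd_def)
    have part: "{..<N} = G \<union> Bd" "G \<inter> Bd = {}" by (auto simp: G_def Bd_def)
    obtain t where t: "0 \<le> t" "t + l \<le> h" and
      big: "\<And>j. j \<in> G \<Longrightarrow> 1 / 2 \<le> sin (M j * (w j \<bullet> v * t + w j \<bullet> (x - c)))"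
      using M[of G "\<lambda>j. w j \<bullet> v" 0 "\<lambda>j. w j \<bullet> (x - c)"] S[OF v] l unfolding G_def
      by fastforce
    have eq: "M j * (w j \<bullet> (x + t *\<^sub>R v - c)) = M j * (w j \<bullet> v * t + w j \<bullet> (x - c))" for j
      by (simp add: inner_simps algebra_simps)
    have cards: "card G + card Bd = 3 * ?d" using part fin by (metis N_def card_Un_disjoint card_lessThan)
    have cB: "card Bd < ?d" using bad[OF v] by (simp add: Bd_def)
    have "f (x + t *\<^sub>R v) = (\<Sum>j\<in>G. sin (M j * (w j \<bullet> (x + t *\<^sub>R v - c))))
        + (\<Sum>j\<in>Bd. sin (M j * (w j \<bullet> (x + t *\<^sub>R v - c))))"
      unfolding f_def part(1) by (rule sum.union_disjoint) (use fin part in auto)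
    also have "\<dots> \<ge> (\<Sum>j\<in>G. 1 / 2) + (\<Sum>j\<in>Bd. - 1)"
      unfolding eq using big by (intro add_mono sum_mono) auto
    finally have "f (x + t *\<^sub>R v) \<ge> card G / 2 - card Bd" by simp
    moreover have "real (card G) / 2 - real (card Bd) \<ge> 1"
    proof -
      have "real (card G) = 3 * ?d - real (card Bd)" using cards by linarith
      moreover have "real (card Bd) + 1 \<le> ?d" using cB by linarith
      ultimately show ?thesis by (simp add: field_simps)
    qed
    ultimately show ?thesis using t l by (intro exI[of _ t]) auto
  qed
  ultimately show thesis using that by blast
qed

section \<open>Removing a point from the sumset\<close>

text \<open>Strict inequality rules out degenerate boxes, so opposite faces have a positive distance
  and a point near one face can move inwards.\<close>

definition box_union :: "(real^'n) set \<Rightarrow> bool" where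
  "box_union X \<longleftrightarrow> (\<exists>B. finite B \<and> (\<forall>(a, b)\<in>B. \<forall>i. a $ i < b $ i) \<and> X = (\<Union>(a, b)\<in>B. cbox a b))"

lemma compact_box_union: "box_union X \<Longrightarrow> compact X"
  unfolding box_union_def by (auto intro!: compact_UN)

text \<open>The compact set \<open>Z \<inter> X\<close> has a positive distance from its reflection,
  so it can be thickened slightly to a union of boxes inside \<open>X\<close> that is still disjoint
  from its own reflection.\<close>

lemma box_union_shrink:
  fixes p :: "real^'n"
  assumes X: "box_union X" and Z: "closed Z" and disj: "\<And>z. z \<in> Z \<Longrightarrow> p - z \<notin> Z"
  obtains X' where "box_union X'" "X' \<subseteq> X" "Z \<inter> X \<subseteq> X'" "\<And>x. x \<in> X' \<Longrightarrow> p - x \<notin> X'"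
proof -
  obtain B where B: "finite B" "\<And>a b i. (a, b) \<in> B \<Longrightarrow> a $ i < b $ i" "X = (\<Union>(a, b)\<in>B. cbox a b)"
    using X unfolding box_union_def by blast
  define Y where "Y = Z \<inter> X"
  have Y: "compact Y" unfolding Y_def using Z compact_box_union[OF X] by (rule closed_Int_compact)
  have "compact ((\<lambda>y. p - y) ` Y)"
    by (intro compact_continuous_image continuous_intros Y)
  moreover have "Y \<inter> (\<lambda>y. p - y) ` Y = {}" using disj by (auto simp: Y_def)
  ultimately obtain e where e: "e > 0" "\<And>x y. x \<in> Y \<Longrightarrow> y \<in> Y \<Longrightarrow> e \<le> dist x (p - y)"
    using separate_compact_closed[OF Y compact_imp_closed] by (metis image_eqI)
  \<comment> \<open>A deviation of \<open>s\<close> per coordinate costs at most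
    \<open>e / 3\<close> in distance; it occurs for \<open>x\<close> and for \<open>p - x\<close>,
    and twice \<open>e / 3\<close> is less than \<open>e\<close>.\<close>
  define s where "s = e / (3 * CARD('n))"
  have s: "s > 0" using e by (simp add: s_def zero_less_card_finite)
  have near: "dist x y \<le> e / 3" if "\<And>i. \<bar>x $ i - y $ i\<bar> \<le> s" for x y :: "real^'n"
  proof -
    have "dist x y \<le> (\<Sum>i\<in>UNIV. \<bar>(x - y) $ i\<bar>)" unfolding dist_norm by (rule norm_le_l1_cart)
    also have "\<dots> \<le> real CARD('n) * s" using that by (intro sum_bounded_above) simp
    also have "\<dots> = e / 3" by (simp add: s_def)
    finally show ?thesis .
  qed
  have "\<exists>F. F \<subseteq> Y \<inter> cbox a b \<and> finite F \<and> Y \<inter> cbox a b \<subseteq> (\<Union>y\<in>F. box (\<chi> i. y $ i - s) (\<chi> i. y $ i + s))"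
    for a b
  proof -
    have "compact (Y \<inter> cbox a b)" using Y closed_cbox by (rule compact_Int_closed)
    moreover have "Y \<inter> cbox a b \<subseteq> (\<Union>y\<in>Y \<inter> cbox a b. box (\<chi> i. y $ i - s) (\<chi> i. y $ i + s))"
      using s by (auto simp: mem_box_cart)
    ultimately obtain F where "F \<subseteq> Y \<inter> cbox a b" "finite F"
      "Y \<inter> cbox a b \<subseteq> (\<Union>y\<in>F. box (\<chi> i. y $ i - s) (\<chi> i. y $ i + s))"
      by (rule compactE_image[OF _ open_box])
    then show ?thesis by (intro exI conjI)
  qed
  then have "\<forall>a b. \<exists>F. F \<subseteq> Y \<inter> cbox a b \<and> finite F \<and>
      Y \<inter> cbox a b \<subseteq> (\<Union>y\<in>F. box (\<chi> i. y $ i - s) (\<chi> i. y $ i + s))"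
    by (intro allI)
  from this[THEN spec, THEN choice]
  have "\<forall>a. \<exists>F. \<forall>b. F b \<subseteq> Y \<inter> cbox a b \<and> finite (F b) \<and>
      Y \<inter> cbox a b \<subseteq> (\<Union>y\<in>F b. box (\<chi> i. y $ i - s) (\<chi> i. y $ i + s))"
    by (intro allI)
  from choice[OF this] obtain F where "\<forall>a b. F a b \<subseteq> Y \<inter> cbox a b \<and> finite (F a b) \<and>
      Y \<inter> cbox a b \<subseteq> (\<Union>y\<in>F a b. box (\<chi> i. y $ i - s) (\<chi> i. y $ i + s))"
    by (elim exE) (rule that)
  then have F: "F a b \<subseteq> Y \<inter> cbox a b" "finite (F a b)"
    "Y \<inter> cbox a b \<subseteq> (\<Union>y\<in>F a b. box (\<chi> i. y $ i - s) (\<chi> i. y $ i + s))" for a b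
    by simp_all
  \<comment> \<open>Corners of the box cut with the cube of half-side \<open>s\<close> about
    \<open>y\<close>. As the centre \<open>y\<close> is chosen in the box, the cut is
    nondegenerate.\<close>
  define lo where "lo a y = (\<chi> i. max (a $ i) (y $ i - s))" for a y :: "real^'n"
  define hi where "hi b y = (\<chi> i. min (b $ i) (y $ i + s))" for b y :: "real^'n"
  have cell: "z \<in> cbox (lo a y) (hi b y) \<longleftrightarrow> z \<in> cbox a b \<and> (\<forall>i. \<bar>z $ i - y $ i\<bar> \<le> s)" for z a b y
    by (auto simp: mem_box_cart lo_def hi_def abs_le_iff algebra_simps)
  define B' where "B' = (\<Union>(a, b)\<in>B. (\<lambda>y. (lo a y, hi b y)) ` F a b)"
  define X' where "X' = (\<Union>(a, b)\<in>B'. cbox a b)"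
  have X'mem: "z \<in> X' \<longleftrightarrow> (\<exists>a b y. (a, b) \<in> B \<and> y \<in> F a b \<and> z \<in> cbox (lo a y) (hi b y))" for z
    unfolding X'_def B'_def by auto
  have "finite B'" unfolding B'_def using B(1) F(2) by auto
  moreover have "lo a y $ i < hi b y $ i" if "(a, b) \<in> B" "y \<in> F a b" for a b y i
  proof -
    have "y \<in> cbox a b" using F(1) that by blast
    then have "a $ i \<le> y $ i" "y $ i \<le> b $ i" by (simp_all add: mem_box_cart)
    then show ?thesis using B(2)[OF that(1), of i] s by (simp add: lo_def hi_def)
  qed
  ultimately have "box_union X'" unfolding box_union_def X'_def
    by (intro exI[of _ B']) (auto simp: B'_def)
  moreover have "X' \<subseteq> X"
    unfolding B(3) subset_iff X'mem cell by blast
  moreover have "Z \<inter> X \<subseteq> X'"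
  proof
    fix z assume z: "z \<in> Z \<inter> X"
    then obtain a b where ab: "(a, b) \<in> B" "z \<in> cbox a b" unfolding B(3) by auto
    then obtain y where y: "y \<in> F a b" "z \<in> box (\<chi> i. y $ i - s) (\<chi> i. y $ i + s)"
      using F(3)[of a b] z unfolding Y_def by blast
    have "\<bar>z $ i - y $ i\<bar> \<le> s" for i
      using y(2) unfolding mem_box_cart by (simp add: abs_le_iff) (smt (verit))
    then show "z \<in> X'" unfolding X'mem cell using ab y(1) by blast
  qed
  moreover have "p - x \<notin> X'" if "x \<in> X'" for x
  proof
    assume "p - x \<in> X'"
    have close: "\<exists>y\<in>Y. dist z y \<le> e / 3" if "z \<in> X'" for z
      using that F(1) near unfolding X'mem cell by blast
    obtain y where y: "y \<in> Y" "dist x y \<le> e / 3" using close[OF \<open>x \<in> X'\<close>] by blast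
    obtain y' where y': "y' \<in> Y" "dist (p - x) y' \<le> e / 3" using close[OF \<open>p - x \<in> X'\<close>] by blast
    have "dist x (p - y') = dist (p - x) y'" by (simp add: dist_norm norm_minus_commute algebra_simps)
    then have "dist y (p - y') \<le> e / 3 + e / 3"
      using y y' dist_triangle3[of y "p - y'" x] by linarith
    then show False using e(1) e(2)[OF y(1) y'(1)] by linarith
  qed
  ultimately show thesis using that by blast
qed

text \<open>Turns a cardinality condition into a finite union of finite intersections, from which
  closedness or openness can be read off.\<close>

lemma Suc_le_card_Collect_iff:
  fixes P :: "'n::finite \<Rightarrow> bool"
  shows "Suc k \<le> card {i. P i} \<longleftrightarrow> (\<exists>S\<in>{S. card S = Suc k}. \<forall>i\<in>S. P i)"
proof
  assume "Suc k \<le> card {i. P i}"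
  then obtain S where "S \<subseteq> {i. P i}" "card S = Suc k" by (rule obtain_subset_with_card_n)
  then show "\<exists>S\<in>{S. card S = Suc k}. \<forall>i\<in>S. P i" by blast
next
  assume "\<exists>S\<in>{S. card S = Suc k}. \<forall>i\<in>S. P i"
  then obtain S where S: "card S = Suc k" "\<And>i. i \<in> S \<Longrightarrow> P i" by blast
  then have "S \<subseteq> {i. P i}" by blast
  then show "Suc k \<le> card {i. P i}" using S(1) card_mono[of "{i. P i}" S] by simp
qed

lemma closed_many_close_coordinates:
  fixes c :: real
  assumes "finite L"
  shows "closed {y :: real^'n. Suc k \<le> card {i. \<exists>l\<in>L. \<bar>y $ i - l\<bar> \<le> c}}"
proof -
  have "{y :: real^'n. Suc k \<le> card {i. \<exists>l\<in>L. \<bar>y $ i - l\<bar> \<le> c}} =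
     (\<Union>S\<in>{S. card S = Suc k}. \<Inter>i\<in>S. \<Union>l\<in>L. {y. \<bar>y $ i - l\<bar> \<le> c})"
    unfolding Suc_le_card_Collect_iff by blast
  then show ?thesis
    using assms by (auto intro!: closed_UN closed_INT closed_Collect_le continuous_intros)
qed

lemma closed_few_close_coordinates:
  fixes q :: "real^'n" and c :: real
  shows "closed {y :: real^'n. card {i. \<exists>l\<in>L. \<bar>q $ i - y $ i - l\<bar> < c} \<le> k}"
proof -
  have "- {y :: real^'n. card {i. \<exists>l\<in>L. \<bar>q $ i - y $ i - l\<bar> < c} \<le> k} =
    {y :: real^'n. Suc k \<le> card {i. \<exists>l\<in>L. \<bar>q $ i - y $ i - l\<bar> < c}}" by auto
  also have "\<dots> = (\<Union>S\<in>{S. card S = Suc k}. \<Inter>i\<in>S. \<Union>l\<in>L. {y. \<bar>q $ i - y $ i - l\<bar> < c})"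
    unfolding Suc_le_card_Collect_iff by blast
  also have "open \<dots>"
    by (intro open_UN open_INT ballI finite open_Collect_less continuous_intros)
  finally show ?thesis by (simp add: closed_def)
qed

text \<open>One step of the construction. \<open>X'\<close> is chosen before \<open>V\<close>: a
  point of \<open>X\<close> either lies in \<open>Z1\<close> and is kept, or reaches
  \<open>Z2\<close> along \<open>V\<close> within its own box.\<close>

lemma box_union_avoid_point:
  fixes X U :: "(real^'n) set"
  assumes X: "box_union X" and U: "open U" "U \<noteq> {}" and d: "CARD('n) \<le> 2 * k"
  obtains X' p where "box_union X'" "X' \<subseteq> X" "p \<in> U" "\<And>x. x \<in> X' \<Longrightarrow> p - x \<notin> X'"
    "\<And>V x. subspace V \<Longrightarrow> k \<le> dim V \<Longrightarrow> x \<in> X \<Longrightarrow> \<exists>x'\<in>X'. x' - x \<in> V"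
proof -
  obtain B where B: "finite B" "\<And>a b i. (a, b) \<in> B \<Longrightarrow> a $ i < b $ i" "X = (\<Union>(a, b)\<in>B. cbox a b)"
    using X unfolding box_union_def by blast
  define L where "L = (\<Union>(a, b)\<in>B. range (($) a) \<union> range (($) b))"
  have L: "finite L" unfolding L_def using B(1) by auto
  have LB: "a $ i \<in> L" "b $ i \<in> L" if "(a, b) \<in> B" for a b i
    unfolding L_def by (rule UN_I[OF that], simp)+
  obtain z e where e: "e > 0" "ball z e \<subseteq> U" using U open_contains_ball by (metis ex_in_conv)
  \<comment> \<open>Moving \<open>z\<close> along the diagonal by \<open>t\<close>, only finitely
    many \<open>t\<close> give \<open>p\<close> a coordinate in \<open>L + L\<close>.\<close>
  define Bad where "Bad = (\<lambda>(l, m, i). l + m - z $ i) ` (L \<times> L \<times> UNIV)"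
  have "finite Bad" unfolding Bad_def using L by auto
  moreover have "infinite {0 <..< e / (1 + norm (1 :: real^'n))}"
    using e(1) by (intro infinite_Ioo divide_pos_pos) (simp_all add: add_pos_nonneg)
  ultimately obtain t where t: "0 < t" "t < e / (1 + norm (1 :: real^'n))" "t \<notin> Bad"
    by (metis Diff_infinite_finite finite.emptyI greaterThanLessThan_iff subsetI subset_empty Diff_iff ex_in_conv)
  define p where "p = z + t *\<^sub>R 1"
  have pU: "p \<in> U"
  proof -
    have "t * (1 + norm (1 :: real^'n)) < e" using t(2) by (simp add: less_divide_eq add_pos_nonneg)
    moreover have "t * norm (1 :: real^'n) \<le> t * (1 + norm (1 :: real^'n))" using t(1) by simp
    ultimately have "t * norm (1 :: real^'n) < e" by linarith
    then have "dist z p < e" using t(1) by (simp add: p_def dist_norm)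
    then show ?thesis using e(2) by auto
  qed
  have gen0: "p $ i - l - m \<noteq> 0" if "l \<in> L" "m \<in> L" for i l m
  proof
    assume "p $ i - l - m = 0"
    then have "t = (\<lambda>(l, m, i). l + m - z $ i) (l, m, i)" by (simp add: p_def)
    then show False using t(3) that unfolding Bad_def by blast
  qed
  \<comment> \<open>All the distances that must stay positive; \<open>u\<close> is a tenth of the
    least, and the 1 keeps the set nonempty.\<close>
  define D where "D = insert 1 ((\<lambda>(l, m, i). \<bar>p $ i - l - m\<bar>) ` (L \<times> L \<times> UNIV) \<union>
    (\<lambda>(l, m). \<bar>l - m\<bar>) ` ((L \<times> L) - Id))"
  have D: "finite D" "D \<noteq> {}" unfolding D_def using L by auto
  have Dpos: "\<forall>x\<in>D. x > 0" unfolding D_def using gen0 by auto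
  define u where "u = Min D / 10"
  have u: "u > 0" using Dpos D by (simp add: u_def)
  have u_le: "10 * u \<le> x" if "x \<in> D" for x using D that by (simp add: u_def)
  have sep: "10 * u \<le> \<bar>l - m\<bar>" if "l \<in> L" "m \<in> L" "l \<noteq> m" for l m
  proof -
    have "(\<lambda>(l, m). \<bar>l - m\<bar>) (l, m) \<in> D"
      unfolding D_def by (intro insertI2 UnI2 imageI) (use that in simp)
    then show ?thesis using u_le by fastforce
  qed
  have gen: "10 * u \<le> \<bar>p $ i - l - m\<bar>" if "l \<in> L" "m \<in> L" for i l m
  proof -
    have "(\<lambda>(l, m, i). \<bar>p $ i - l - m\<bar>) (l, m, i) \<in> D"
      unfolding D_def by (intro insertI2 UnI1 imageI) (use that in simp)
    then show ?thesis using u_le by fastforce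
  qed
  have half_pos: "u / 2 > 0" using u by simp
  obtain f :: "real^'n \<Rightarrow> real" where f: "continuous_on UNIV f" "\<forall>y. f (2 *\<^sub>R ((1/2) *\<^sub>R p) - y) = - f y"
    "\<forall>x v. (\<forall>i. \<bar>v $ i\<bar> \<le> 1) \<longrightarrow> (\<exists>i. \<bar>v $ i\<bar> = 1) \<longrightarrow> (\<exists>t. 0 \<le> t \<and> t \<le> u / 2 \<and> 1 \<le> f (x + t *\<^sub>R v))"
    by (rule odd_function_large_on_segments[OF half_pos, of "(1/2) *\<^sub>R p"])
  have fodd: "f (p - y) = - f y" for y using f(2)[rule_format, of y] by simp
  \<comment> \<open>\<open>Z1\<close> uses closeness \<open>u / 2\<close> and \<open>Z2\<close>
    strict closeness \<open>u\<close>: both sets are closed, and reflecting a point of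
    \<open>Z2\<close> cannot give a point of \<open>Z1\<close>.\<close>
  define Z1 where "Z1 = {y :: real^'n. Suc k \<le> card {i. \<exists>l\<in>L. \<bar>y $ i - l\<bar> \<le> u / 2}}"
  define Z2 where "Z2 = {y :: real^'n. 1 \<le> f y} \<inter> {y. card {i. \<exists>l\<in>L. \<bar>p $ i - y $ i - l\<bar> < u} \<le> k}"
  have "closed Z1" unfolding Z1_def using L by (rule closed_many_close_coordinates)
  moreover have "closed Z2" unfolding Z2_def
    by (intro closed_Int closed_few_close_coordinates closed_Collect_le continuous_intros f)
  ultimately have Z: "closed (Z1 \<union> Z2)" by (rule closed_Un)
  have sub: "card {i. \<exists>l\<in>L. \<bar>y $ i - l\<bar> \<le> u / 2} \<le> card {i. \<exists>l\<in>L. \<bar>y $ i - l\<bar> < u}" for y :: "real^'n"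
    using u by (intro card_mono) force+
  have Z12: "p - y \<notin> Z1" if "y \<in> Z2" for y
    using sub[of "p - y"] that unfolding Z1_def Z2_def by simp
  have Z21: "p - y \<notin> Z2" if "y \<in> Z1" for y
    using Z12[of "p - y"] that by auto
  have Z11: "p - y \<notin> Z1" if "y \<in> Z1" for y
  proof
    assume "p - y \<in> Z1"
    let ?S = "{i. \<exists>l\<in>L. \<bar>y $ i - l\<bar> \<le> u / 2}" and ?T = "{i. \<exists>l\<in>L. \<bar>(p - y) $ i - l\<bar> \<le> u / 2}"
    have "Suc k \<le> card ?S" "Suc k \<le> card ?T" using that \<open>p - y \<in> Z1\<close> unfolding Z1_def by auto
    moreover have "card (?S \<union> ?T) \<le> CARD('n)" by (simp add: card_mono)
    \<comment> \<open>Two sets of at least k + 1 indices among at most 2 k must meet; a common index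
      would put \<open>p $ i\<close> within \<open>u\<close> of \<open>l + m\<close>.\<close>
    ultimately have "?S \<inter> ?T \<noteq> {}" using card_Un_disjoint[of ?S ?T] d by force
    then obtain i l m where "l \<in> L" "m \<in> L" "\<bar>y $ i - l\<bar> \<le> u / 2" "\<bar>p $ i - y $ i - m\<bar> \<le> u / 2" by auto
    then show False using gen[of l m i] u by linarith
  qed
  have Z22: "p - y \<notin> Z2" if "y \<in> Z2" for y
    using that fodd[of y] unfolding Z2_def by auto
  have "p - z \<notin> Z1 \<union> Z2" if "z \<in> Z1 \<union> Z2" for z using that Z11 Z12 Z21 Z22 by blast
  then obtain X' where X': "box_union X'" "X' \<subseteq> X" "(Z1 \<union> Z2) \<inter> X \<subseteq> X'" "\<And>x. x \<in> X' \<Longrightarrow> p - x \<notin> X'"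
    using box_union_shrink[OF X Z] by metis
  have "\<exists>x'\<in>X'. x' - x \<in> V" if V: "subspace V" "k \<le> dim V" and x: "x \<in> X" for V x
  proof (cases "x \<in> Z1")
    case True
    then have "x \<in> X'" using X'(3) x by blast
    then show ?thesis using V by (intro bexI[of _ x]) (auto simp: subspace_0)
  next
    case False
    then have far: "card {i. \<exists>l\<in>L. \<bar>x $ i - l\<bar> \<le> u / 2} \<le> k" unfolding Z1_def by simp
    obtain a b where ab: "(a, b) \<in> B" "x \<in> cbox a b" using x unfolding B(3) by auto
    obtain y v where yv: "y - x \<in> V" "v \<in> V" "\<forall>i. \<bar>v $ i\<bar> \<le> 1" "\<exists>i. \<bar>v $ i\<bar> = 1"
      "\<forall>t. 0 \<le> t \<and> t \<le> u / 2 \<longrightarrow> y + t *\<^sub>R v \<in> cbox a b \<and>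
        card {i. \<exists>l\<in>L. \<bar>p $ i - (y + t *\<^sub>R v) $ i - l\<bar> < u} \<le> k"
      by (rule segment_off_reflected_corners[OF V d u ab(2) B(2)[OF ab(1)] LB[OF ab(1)] sep gen far])
    obtain t where t: "0 \<le> t" "t \<le> u / 2" "1 \<le> f (y + t *\<^sub>R v)" using f(3) yv(3,4) by blast
    have "y + t *\<^sub>R v \<in> X" using yv(5) t(1,2) ab(1) unfolding B(3) by blast
    moreover have "y + t *\<^sub>R v \<in> Z2" using yv(5) t(1,2) t(3) unfolding Z2_def by blast
    ultimately have "y + t *\<^sub>R v \<in> X'" using X'(3) by blast
    moreover have "y + t *\<^sub>R v - x \<in> V"
    proof -
      have "(y - x) + t *\<^sub>R v \<in> V" using V yv by (intro subspace_add subspace_mul)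
      then show ?thesis by (simp add: algebra_simps)
    qed
    ultimately show ?thesis by blast
  qed
  then show thesis using that X'(1,2,4) pU by blast
qed

section \<open>The intersection of the decreasing sequence\<close>

lemma compact_set_plus:
  fixes S T :: "'a::real_normed_vector set"
  assumes "compact S" "compact T"
  shows "compact (S + T)"
proof -
  have "S + T = {x + y |x y. x \<in> S \<and> y \<in> T}" unfolding set_plus_def by blast
  then show ?thesis using compact_sums[OF assms] by simp
qed

lemma affine_direction:
  fixes A :: "'a::euclidean_space set"
  assumes "affine A" "x \<in> A" "aff_dim A = int k"
  obtains V where "subspace V" "dim V = k" "\<And>y. y \<in> A \<longleftrightarrow> y - x \<in> V"
proof
  show "subspace ((+) (- x) ` A)" using assms affine_diffs_subspace by blast
  show "dim ((+) (- x) ` A) = k" using assms aff_dim_eq_dim[of x A] by (simp add: hull_inc)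
  show "y \<in> A \<longleftrightarrow> y - x \<in> (+) (- x) ` A" for y by (auto simp: image_iff)
qed

text \<open>Stage \<open>n\<close> removes a point of the \<open>n\<close>-th nonempty basic open
  set from the sumset, so the closed set \<open>K + K\<close> contains no such set. A plane meets
  every stage, hence by compactness the intersection.\<close>

lemma exists_compact_meeting_planes_nowhere_dense_sumset:
  assumes d: "CARD('n) \<le> 2 * k"
  shows "\<exists>K :: (real ^ 'n) set. compact K \<and> K \<subseteq> unit_cube \<and>
    (\<forall>A :: (real ^ 'n) set. affine A \<and> aff_dim A = int k \<and> A \<inter> unit_cube \<noteq> {} \<longrightarrow> K \<inter> A \<noteq> {}) \<and>
    nowhere_dense (K + K)"
proof -
  obtain \<B> :: "(real^'n) set set" where \<B>: "countable \<B>" "topological_basis \<B>"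
    using ex_countable_basis by blast
  have "\<B> - {{}} \<noteq> {}" using topological_basisE[OF \<B>(2) open_UNIV UNIV_I] by blast
  moreover have "countable (\<B> - {{}})" using \<B>(1) by simp
  ultimately have U_range: "range (from_nat_into (\<B> - {{}})) = \<B> - {{}}" by (rule range_from_nat_into)
  define U where "U = from_nat_into (\<B> - {{}})"
  have U: "U n \<in> \<B> - {{}}" for n unfolding U_def using U_range by blast
  have Uopen: "open (U n)" "U n \<noteq> {}" for n using U[of n] topological_basis_open[OF \<B>(2)] by auto
  have cube: "box_union (unit_cube :: (real^'n) set)"
  proof -
    have "unit_cube = cbox 0 (1 :: real^'n)" by (auto simp: unit_cube_def mem_box_cart)
    then show ?thesis unfolding box_union_def by (intro exI[of _ "{(0, 1)}"]) simp
  qed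
  \<comment> \<open>The implication from \<open>n = 0\<close> prescribes the first term within
    dependent choice.\<close>
  have "\<exists>X. \<forall>n. ((n = 0 \<longrightarrow> X n = unit_cube) \<and> box_union (X n)) \<and>
     (X (Suc n) \<subseteq> X n \<and> (\<exists>p\<in>U n. \<forall>x\<in>X (Suc n). p - x \<notin> X (Suc n)) \<and>
      (\<forall>V. \<forall>x\<in>X n. subspace V \<longrightarrow> k \<le> dim V \<longrightarrow> (\<exists>x'\<in>X (Suc n). x' - x \<in> V)))"
  proof (rule dependent_nat_choice)
    show "\<exists>X :: (real^'n) set. (0 = (0::nat) \<longrightarrow> X = unit_cube) \<and> box_union X" using cube by blast
    show "\<exists>Y. ((Suc n = 0 \<longrightarrow> Y = unit_cube) \<and> box_union Y) \<and> (Y \<subseteq> X \<and>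
       (\<exists>p\<in>U n. \<forall>x\<in>Y. p - x \<notin> Y) \<and>
       (\<forall>V. \<forall>x\<in>X. subspace V \<longrightarrow> k \<le> dim V \<longrightarrow> (\<exists>x'\<in>Y. x' - x \<in> V)))"
      if "(n = 0 \<longrightarrow> X = unit_cube) \<and> box_union X" for X :: "(real^'n) set" and n
      using box_union_avoid_point[OF conjunct2[OF that] Uopen[of n] d] by (metis old.nat.distinct(2))
  qed
  then obtain X where X0: "X 0 = unit_cube" and bX: "\<And>n. box_union (X n)"
    and dec: "\<And>n. X (Suc n) \<subseteq> X n" and gap: "\<And>n. \<exists>p\<in>U n. \<forall>x\<in>X (Suc n). p - x \<notin> X (Suc n)"
    and hit: "\<And>n V x. x \<in> X n \<Longrightarrow> subspace V \<Longrightarrow> k \<le> dim V \<Longrightarrow> \<exists>x'\<in>X (Suc n). x' - x \<in> V"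
    by metis
  have anti: "X n \<subseteq> X m" if "m \<le> n" for m n
    using dec that by (rule lift_Suc_antimono_le[where f=X])
  have cX: "compact (X n)" for n by (rule compact_box_union[OF bX])
  define K where "K = (\<Inter>n. X n)"
  have K: "compact K" unfolding K_def using cX by (intro compact_Inter) auto
  have KX: "K \<subseteq> X n" for n unfolding K_def by blast
  have "K \<inter> A \<noteq> {}" if A: "affine A" "aff_dim A = int k" "A \<inter> unit_cube \<noteq> {}" for A :: "(real^'n) set"
  proof -
    have "X n \<inter> A \<noteq> {}" for n
    proof (induction n)
      case 0
      then show ?case using A(3) X0 by auto
    next
      case (Suc n)
      then obtain x where x: "x \<in> X n" "x \<in> A" by blast
      obtain V where V: "subspace V" "dim V = k" "\<And>y. y \<in> A \<longleftrightarrow> y - x \<in> V"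
        using affine_direction[OF A(1) x(2) A(2)] by metis
      obtain x' where "x' \<in> X (Suc n)" "x' - x \<in> V" using hit[OF x(1) V(1)] V(2) by blast
      then show ?case using V(3) by blast
    qed
    then have "(\<Inter>n. X n \<inter> A) \<noteq> {}"
      using cX A(1) by (intro compact_nest compact_Int_closed affine_closed Int_mono anti) simp_all
    then show ?thesis unfolding K_def by blast
  qed
  moreover have "nowhere_dense (K + K)"
  proof -
    have cl: "closed (K + K)" using compact_set_plus[OF K K] by (rule compact_imp_closed)
    have "interior (K + K) = {}"
    proof (rule ccontr)
      assume "interior (K + K) \<noteq> {}"
      then obtain z where z: "z \<in> interior (K + K)" by blast
      obtain O' where O': "O' \<in> \<B>" "z \<in> O'" "O' \<subseteq> interior (K + K)"
        using topological_basisE[OF \<B>(2) open_interior z] by blast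
      then obtain n where n: "O' = U n" unfolding U_def using U_range by (metis Diff_iff empty_iff imageE singletonD)
      obtain p where p: "p \<in> U n" "\<And>x. x \<in> X (Suc n) \<Longrightarrow> p - x \<notin> X (Suc n)" using gap by blast
      then have "p \<in> K + K" using O'(3) n interior_subset by blast
      then obtain x y where xy: "x \<in> K" "y \<in> K" "p = x + y" by (rule set_plus_elim)
      then have "p - x \<in> X (Suc n)" using KX by auto
      then show False using p(2) xy(1) KX by blast
    qed
    then show ?thesis unfolding nowhere_dense_def using cl by simp
  qed
  moreover have "K \<subseteq> unit_cube" using KX X0 by blast
  ultimately show ?thesis using K by blast
qed

section \<open>Planes of dimension less than half\<close>

text \<open>Vectors supported on \<open>J\<close> with coordinate sum zero form a space of dimension
  at least \<open>card J - 1\<close>, hence at least \<open>k\<close>. A nonzero one has a negative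
  coordinate and leads out of the cube from \<open>x\<close>, so some \<open>k\<close>-plane meets
  the cube in \<open>x\<close> only.\<close>

lemma coordinate_face_subset:
  fixes K :: "(real^'n) set"
  assumes hit: "\<And>A. affine A \<Longrightarrow> aff_dim A = int k \<Longrightarrow> A \<inter> unit_cube \<noteq> {} \<Longrightarrow> K \<inter> A \<noteq> {}"
    and sub: "K \<subseteq> unit_cube" and J: "k < card J"
    and x: "x \<in> unit_cube" "\<And>j. j \<in> J \<Longrightarrow> x $ j = 0"
  shows "x \<in> K"
proof -
  define W where "W = {v :: real^'n. \<forall>i. i \<notin> J \<longrightarrow> v $ i = 0}"
  define o1 :: "real^'n" where "o1 = 1"
  have W: "subspace W" unfolding W_def subspace_def by auto
  have dW: "dim W = card J"
    unfolding W_def by (rule dim_coordinate_subspace)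
  have H: "subspace {v. o1 \<bullet> v = 0}" by (rule subspace_hyperplane)
  have "o1 \<noteq> 0" by (simp add: o1_def)
  then have dH: "dim {v. o1 \<bullet> v = 0} = CARD('n) - 1" using dim_hyperplane[of o1] by simp
  have "dim {x + y |x y. x \<in> W \<and> y \<in> {v. o1 \<bullet> v = 0}} \<le> CARD('n)"
    by (rule dim_subset_UNIV_cart)
  moreover have "card J \<le> CARD('n)" by (simp add: card_mono)
  ultimately have "k \<le> dim (W \<inter> {v. o1 \<bullet> v = 0})"
    using dim_sums_Int[OF W H] dW dH J by linarith
  then obtain V where V: "subspace V" "V \<subseteq> span (W \<inter> {v. o1 \<bullet> v = 0})" "dim V = k"
    by (rule choose_subspace_of_subspace)
  have VW: "V \<subseteq> W \<inter> {v. o1 \<bullet> v = 0}"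
    using V(2) span_eq_iff[THEN iffD2, OF subspace_inter[OF W H]] by (rule ord_le_eq_trans)
  define A where "A = (+) x ` V"
  have "x + 0 \<in> A" unfolding A_def by (rule imageI) (rule subspace_0[OF V(1)])
  then have "A \<inter> unit_cube \<noteq> {}" using x(1) by auto
  moreover have "affine A" unfolding A_def by (rule affine_translation[THEN iffD1, OF subspace_imp_affine[OF V(1)]])
  moreover have "aff_dim A = int k"
    unfolding A_def aff_dim_translation_eq using V by (simp add: aff_dim_subspace)
  ultimately obtain v where v: "v \<in> V" "x + v \<in> K" using hit[of A] unfolding A_def by blast
  have nonneg: "0 \<le> v $ i" for i
  proof (cases "i \<in> J")
    case True
    have "0 \<le> (x + v) $ i" using v(2) sub unfolding unit_cube_def by blast
    then show ?thesis using x(2)[OF True] by simp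
  next
    case False
    then show ?thesis using VW v(1) unfolding W_def by force
  qed
  have "(\<Sum>i\<in>UNIV. v $ i) = 0"
    using VW v(1) by (auto simp: o1_def inner_vec_def)
  then have "v = 0"
    using sum_nonneg_eq_0_iff[of UNIV "\<lambda>i. v $ i"] nonneg by (simp add: vec_eq_iff)
  then show ?thesis using v(2) by simp
qed

text \<open>A finite form of Baire's theorem: a set with empty interior adds nothing to the interior
  of a closed set.\<close>

lemma interior_Union_closed_nonempty:
  fixes F :: "'a::topological_space set set"
  assumes "finite F" "\<And>S. S \<in> F \<Longrightarrow> closed S" "interior (\<Union>F) \<noteq> {}"
  shows "\<exists>S\<in>F. interior S \<noteq> {}"
  using assms
proof (induction F)
  case (insert S F)
  show ?case
  proof (cases "interior (\<Union>F) = {}")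
    case True
    then have "interior (S \<union> \<Union>F) = interior S"
      using insert.prems(1) by (intro interior_closed_Un_empty_interior) simp_all
    then show ?thesis using insert.prems(2) by simp
  next
    case False
    then show ?thesis using insert by simp
  qed
qed simp

lemma interior_sumset_nonempty:
  fixes K :: "(real^'n) set"
  assumes K: "compact K" and sub: "K \<subseteq> unit_cube" and k: "2 * k < CARD('n)"
    and hit: "\<And>A. affine A \<Longrightarrow> aff_dim A = int k \<Longrightarrow> A \<inter> unit_cube \<noteq> {} \<Longrightarrow> K \<inter> A \<noteq> {}"
  shows "interior (K + K) \<noteq> {}"
proof -
  have "k \<le> card (UNIV :: 'n set)" using k by simp
  then obtain I :: "'n set" where I: "card I = k" using obtain_subset_with_card_n by blast
  have "card (- I) = CARD('n) - k" using I by (simp add: card_Diff_subset Compl_eq_Diff_UNIV)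
  then have J: "k < card (- I)" using k by simp
  define W where "W = {v :: real^'n. \<forall>i. i \<notin> I \<longrightarrow> v $ i = 0}"
  have W: "subspace W" unfolding W_def subspace_def by auto
  have dW: "dim W = k"
    unfolding W_def dim_coordinate_subspace by (rule I)
  have KK: "closed (K + K)" using compact_set_plus[OF K K] by (rule compact_imp_closed)
  \<comment> \<open>The shift makes \<open>s T + y - z\<close> lie in the cube: with
    \<open>y $ i\<close> in [0, 1/2], add 1/2 where \<open>z $ i\<close> is at most 1/2, and 1 where
    it is larger. Off \<open>I\<close> the difference vanishes, so this point is in the face
    contained in \<open>K\<close>. There are only finitely many shifts.\<close>
  define s :: "'n set \<Rightarrow> real^'n" where "s T = (\<chi> i. if i \<in> I then if i \<in> T then 1 / 2 else 1 else 0)" for T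
  define F where "F = range (\<lambda>T. (+) (- s T) ` (K + K))"
  have "cbox 0 (\<chi> i. 1 / 2) \<subseteq> \<Union>F"
  proof
    fix y :: "real^'n" assume "y \<in> cbox 0 (\<chi> i. 1 / 2)"
    then have y: "0 \<le> y $ i" "y $ i \<le> 1 / 2" for i by (simp_all add: mem_box_cart)
    have "y + 0 \<in> (+) y ` W" by (rule imageI) (rule subspace_0[OF W])
    moreover have "y \<in> unit_cube" unfolding unit_cube_def
      by (auto simp: y intro: order_trans[OF y(2)])
    ultimately have "(+) y ` W \<inter> unit_cube \<noteq> {}" by auto
    moreover have "affine ((+) y ` W)"
      by (rule affine_translation[THEN iffD1, OF subspace_imp_affine[OF W]])
    moreover have "aff_dim ((+) y ` W) = int k"
      unfolding aff_dim_translation_eq using W dW by (simp add: aff_dim_subspace)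
    ultimately obtain w where w: "w \<in> W" "y + w \<in> K" using hit[of "(+) y ` W"] by blast
    define z where "z = y + w"
    have z: "0 \<le> z $ i" "z $ i \<le> 1" for i
      using w(2) sub unfolding z_def[symmetric] unit_cube_def by auto
    have zy: "z $ i = y $ i" if "i \<notin> I" for i using w(1) that by (simp add: z_def W_def)
    define T where "T = {i. z $ i \<le> 1 / 2}"
    define x where "x = s T + y - z"
    have x0: "x $ i = 0" if "i \<in> - I" for i using that zy by (simp add: x_def s_def)
    have "0 \<le> x $ i \<and> x $ i \<le> 1" for i
    proof (cases "i \<in> I")
      case True
      then show ?thesis using y[of i] z[of i] by (simp add: x_def s_def T_def)
    next
      case False
      then show ?thesis using x0 by simp
    qed
    then have "x \<in> unit_cube" by (simp add: unit_cube_def)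
    then have "x \<in> K" using coordinate_face_subset[OF hit sub J _ x0] by blast
    then have "z + x \<in> K + K" using w(2) unfolding z_def by (rule set_plus_intro[rotated])
    moreover have "y = - s T + (z + x)" by (simp add: x_def)
    ultimately show "y \<in> \<Union>F" unfolding F_def by blast
  qed
  then have "box 0 (\<chi> i. 1 / 2) \<subseteq> interior (\<Union>F)"
    by (intro interior_maximal open_box order_trans[OF box_subset_cbox])
  moreover have "(\<chi> i. 1 / 4) \<in> box 0 ((\<chi> i. 1 / 2) :: real^'n)" by (simp add: mem_box_cart)
  ultimately have "interior (\<Union>F) \<noteq> {}" by blast
  moreover have "finite F" unfolding F_def by simp
  moreover have "closed S" if "S \<in> F" for S
    using that unfolding F_def by (elim rangeE) (simp only: closed_translation[OF KK])
  ultimately obtain S where "S \<in> F" "interior S \<noteq> {}"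
    using interior_Union_closed_nonempty by blast
  then obtain T where "interior ((+) (- s T) ` (K + K)) \<noteq> {}" unfolding F_def by blast
  then show ?thesis by (simp only: interior_translation image_is_empty not_False_eq_True)
qed

theorem corollary8p2:
  fixes d k :: nat
  assumes "CARD('n::finite) = d" and "d \<ge> 2" and "k < d"
  shows "real k \<ge> real d / 2 \<longleftrightarrow>
    (\<exists>K :: (real ^ 'n) set.
       compact K \<and> K \<subseteq> unit_cube \<and>
       (\<forall>A :: (real ^ 'n) set.
          affine A \<and> aff_dim A = int k \<and> A \<inter> unit_cube \<noteq> {} \<longrightarrow> K \<inter> A \<noteq> {}) \<and>
       nowhere_dense (K + K))"
proof
  assume "real k \<ge> real d / 2"
  then have "CARD('n) \<le> 2 * k" using assms(1) by simp
  then show "\<exists>K :: (real ^ 'n) set.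
       compact K \<and> K \<subseteq> unit_cube \<and>
       (\<forall>A :: (real ^ 'n) set.
          affine A \<and> aff_dim A = int k \<and> A \<inter> unit_cube \<noteq> {} \<longrightarrow> K \<inter> A \<noteq> {}) \<and>
       nowhere_dense (K + K)"
    by (rule exists_compact_meeting_planes_nowhere_dense_sumset)
next
  assume "\<exists>K :: (real ^ 'n) set.
       compact K \<and> K \<subseteq> unit_cube \<and>
       (\<forall>A :: (real ^ 'n) set.
          affine A \<and> aff_dim A = int k \<and> A \<inter> unit_cube \<noteq> {} \<longrightarrow> K \<inter> A \<noteq> {}) \<and>
       nowhere_dense (K + K)"
  then obtain K :: "(real ^ 'n) set" where K: "compact K" "K \<subseteq> unit_cube" "nowhere_dense (K + K)"
    and hit: "\<forall>A :: (real ^ 'n) set.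
          affine A \<and> aff_dim A = int k \<and> A \<inter> unit_cube \<noteq> {} \<longrightarrow> K \<inter> A \<noteq> {}"
    by (elim exE conjE) (rule that)
  have "interior (K + K) = {}"
    using K(3) interior_mono[OF closure_subset[of "K + K"]] unfolding nowhere_dense_def by (simp only: subset_empty)
  moreover have "K \<inter> A \<noteq> {}" if "affine A" "aff_dim A = int k" "A \<inter> unit_cube \<noteq> {}" for A
    using hit that by simp
  ultimately have "\<not> 2 * k < CARD('n)"
    using interior_sumset_nonempty[OF K(1,2)] by metis
  then show "real k \<ge> real d / 2" using assms(1) by simp
qed

end
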